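(* Let $(M,g)$ be an $n$-dimensional ($n>3$) weakly $Z$ symmetric manifold $(WZS)_n$ with non singular $Z$ tensor, and let $K_{jkl}{}^m$ be a generalized curvature tensor on $M$ such that $$\nabla_mK_{jkl}{}^m=A\,\nabla_mR_{jkl}{}^m+B\,(g_{kl}\nabla_j-g_{jl}\nabla_k)R$$ for constants $A\neq0$ and $B$. Suppose $M$ is $K$-harmonic, i.e. $\nabla_mK_{jkl}{}^m=0$. If $\omega\neq0$, where $\omega_k=A_k-B_k$, then $\omega$ is a closed 1-form.
   Context: $(M,g)$ is an $n$-dimensional Riemannian manifold with Levi-Civita connection $\nabla$; index notation with summation over repeated indices; $R_{jkl}{}^m$ is the Riemann tensor, $R_{kl}=-R_{mkl}{}^m$ the Ricci tensor, $R=g^{ij}R_{ij}$ the scalar curvature. Generalized $Z$ tensor: $Z_{kl}=R_{kl}+\phi\,g_{kl}$, where $\phi$ is an arbitrary scalar function. The manifold is weakly $Z$ symmetric, $(WZS)_n$, if for some $\phi$ there are covectors $A_k,B_k,D_k$ (carrying an index, not to be confused with the constants $A,B$) with $$\nabla_kZ_{jl}=A_kZ_{jl}+B_jZ_{kl}+D_lZ_{kj}.$$ The $Z$ tensor is non singular if there is a $(2,0)$ tensor $Z^{-1}$ with $(Z^{-1})^{kh}Z_{kl}=\delta^h{}_l$. A 1-form $\omega_k$ is closed if $\nabla_i\omega_j-\nabla_j\omega_i=0$. A generalized curvature tensor is a tensor $K_{jkl}{}^m$ with $K_{jkl}{}^m=-K_{kjl}{}^m$ and $K_{jkl}{}^m+K_{klj}{}^m+K_{ljk}{}^m=0$.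 *)

theory Defs
  imports "HOL-Analysis.Analysis"
begin

section \<open>Smooth functions on open subsets of Euclidean space\<close>

definition partial_deriv :: "'n::finite \<Rightarrow> (real^'n \<Rightarrow> real) \<Rightarrow> real^'n \<Rightarrow> real" where
  "partial_deriv k f x = frechet_derivative f (at x) (axis k 1)"

fun iter_partial :: "'n::finite list \<Rightarrow> (real^'n \<Rightarrow> real) \<Rightarrow> real^'n \<Rightarrow> real" where
  "iter_partial [] f = f"
| "iter_partial (k # ks) f = partial_deriv k (iter_partial ks f)"

(* Meant for open U: all iterated partial derivatives exist and are (Frechet) differentiable
   on U, hence continuous, which is the same as f being of class C^infinity on U. *)
definition smooth_fun_on :: "(real^'n::finite) set \<Rightarrow> (real^'n \<Rightarrow> real) \<Rightarrow> bool" where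
  "smooth_fun_on U f \<longleftrightarrow> (\<forall>ks. \<forall>x\<in>U. iter_partial ks f differentiable (at x))"


section \<open>Smooth manifolds of dimension CARD('n)\<close>

(* A chart is a pair of its domain U in the manifold and its coordinate map;
   the values of the coordinate map outside U are irrelevant. *)
type_synonym ('a, 'n) chart = "'a set \<times> ('a \<Rightarrow> real^'n)"

abbreviation chart_dom :: "('a, 'n::finite) chart \<Rightarrow> 'a set" where
  "chart_dom \<equiv> fst"

abbreviation chart_map :: "('a, 'n::finite) chart \<Rightarrow> 'a \<Rightarrow> real^'n" where
  "chart_map \<equiv> snd"

definition chart_img :: "('a, 'n::finite) chart \<Rightarrow> (real^'n) set" where
  "chart_img c = chart_map c ` chart_dom c"

definition overlap :: "('a, 'n::finite) chart \<Rightarrow> ('a, 'n) chart \<Rightarrow> (real^'n) set" where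
  "overlap c c' = chart_map c ` (chart_dom c \<inter> chart_dom c')"

(* The change of coordinates from c to c', meaningful on overlap c c'. *)
definition transition :: "('a, 'n::finite) chart \<Rightarrow> ('a, 'n) chart \<Rightarrow> real^'n \<Rightarrow> real^'n" where
  "transition c c' x = chart_map c' (inv_into (chart_dom c) (chart_map c) x)"

definition is_chart :: "'a topology \<Rightarrow> ('a, 'n::finite) chart \<Rightarrow> bool" where
  "is_chart M c \<longleftrightarrow>
     openin M (chart_dom c) \<and> open (chart_img c) \<and>
     homeomorphic_map (subtopology M (chart_dom c)) (top_of_set (chart_img c)) (chart_map c)"

definition smooth_manifold :: "'a topology \<Rightarrow> ('a, 'n::finite) chart set \<Rightarrow> bool" where
  "smooth_manifold M \<A> \<longleftrightarrow>
     Hausdorff_space M \<and> second_countable M \<and>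
     (\<forall>c\<in>\<A>. is_chart M c) \<and>
     (\<Union>c\<in>\<A>. chart_dom c) = topspace M \<and>
     (\<forall>c\<in>\<A>. \<forall>c'\<in>\<A>. \<forall>i. smooth_fun_on (overlap c c') (\<lambda>x. transition c c' x $ i))"


section \<open>Tensor fields\<close>

(* T c us ls x is the component, in the chart c and at the point with coordinates x, with
   upper indices us and lower indices ls. In the index notation T_{jkl}^m it is
   T c [m] [j, k, l] x. A scalar field is a tensor field of type (0,0).
   Only index lists whose lengths match the type of the tensor are meaningful. *)
type_synonym ('a, 'n) components =
  "('a, 'n) chart \<Rightarrow> 'n list \<Rightarrow> 'n list \<Rightarrow> real^'n \<Rightarrow> real"

(* The Jacobian d x'^i / d x^p at the point with c-coordinates x. *)
definition jacobian ::
  "('a, 'n::finite) chart \<Rightarrow> ('a, 'n) chart \<Rightarrow> real^'n \<Rightarrow> 'n \<Rightarrow> 'n \<Rightarrow> real" where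
  "jacobian c c' x i p = partial_deriv p (\<lambda>y. transition c c' y $ i) x"

definition tensor_field ::
  "('a, 'n::finite) chart set \<Rightarrow> nat \<Rightarrow> nat \<Rightarrow> ('a, 'n) components \<Rightarrow> bool" where
  "tensor_field \<A> r s T \<longleftrightarrow>
     (\<forall>c\<in>\<A>. \<forall>us ls. length us = r \<and> length ls = s \<longrightarrow> smooth_fun_on (chart_img c) (T c us ls)) \<and>
     (\<forall>c\<in>\<A>. \<forall>c'\<in>\<A>. \<forall>x\<in>overlap c c'. \<forall>us ls. length us = r \<and> length ls = s \<longrightarrow>
        T c' us ls (transition c c' x) =
          (\<Sum>ps | length ps = r. \<Sum>qs | length qs = s.
             (\<Prod>a<r. jacobian c c' x (us ! a) (ps ! a)) *
             (\<Prod>b<s. jacobian c' c (transition c c' x) (qs ! b) (ls ! b)) *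
             T c ps qs x))"

definition riemannian_metric ::
  "('a, 'n::finite) chart set \<Rightarrow> ('a, 'n) components \<Rightarrow> bool" where
  "riemannian_metric \<A> g \<longleftrightarrow>
     tensor_field \<A> 0 2 g \<and>
     (\<forall>c\<in>\<A>. \<forall>x\<in>chart_img c.
        (\<forall>i j. g c [] [i, j] x = g c [] [j, i] x) \<and>
        (\<forall>v. v \<noteq> 0 \<longrightarrow> (\<Sum>i\<in>UNIV. \<Sum>j\<in>UNIV. g c [] [i, j] x * v $ i * v $ j) > 0))"

definition riemannian_manifold ::
  "'a topology \<Rightarrow> ('a, 'n::finite) chart set \<Rightarrow> ('a, 'n) components \<Rightarrow> bool" where
  "riemannian_manifold M \<A> g \<longleftrightarrow> smooth_manifold M \<A> \<and> riemannian_metric \<A> g"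


section \<open>Levi-Civita connection and curvature\<close>

definition inv_metric ::
  "('a, 'n::finite) components \<Rightarrow> ('a, 'n) chart \<Rightarrow> 'n \<Rightarrow> 'n \<Rightarrow> real^'n \<Rightarrow> real" where
  "inv_metric g c i j x = matrix_inv (\<chi> p q. g c [] [p, q] x) $ i $ j"

(* christoffel g c m i j is the Christoffel symbol with upper index m and lower indices i, j. *)
definition christoffel ::
  "('a, 'n::finite) components \<Rightarrow> ('a, 'n) chart \<Rightarrow> 'n \<Rightarrow> 'n \<Rightarrow> 'n \<Rightarrow> real^'n \<Rightarrow> real" where
  "christoffel g c m i j x =
     (\<Sum>p\<in>UNIV. inv_metric g c m p x *
        (partial_deriv i (g c [] [p, j]) x + partial_deriv j (g c [] [i, p]) x
          - partial_deriv p (g c [] [i, j]) x)) / 2"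

(* The covariant derivative; the index of differentiation is the first lower index of
   the result. *)
fun nabla :: "('a, 'n::finite) components \<Rightarrow> ('a, 'n) components \<Rightarrow> ('a, 'n) components" where
  "nabla g T c us (k # ls) x =
     partial_deriv k (T c us ls) x
     + (\<Sum>a<length us. \<Sum>p\<in>UNIV. christoffel g c (us ! a) k p x * T c (us[a := p]) ls x)
     - (\<Sum>b<length ls. \<Sum>p\<in>UNIV. christoffel g c p k (ls ! b) x * T c us (ls[b := p]) x)"
| "nabla g T c us [] x = 0"

(* R_{jkl}^m, with the sign fixed by nabla_j nabla_k u_l - nabla_k nabla_j u_l = R_{jkl}^m u_m.
   With this sign, R_{kl} = - R_{mkl}^m is the usual Ricci tensor, positive on round spheres. *)
fun riemann :: "('a, 'n::finite) components \<Rightarrow> ('a, 'n) components" where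
  "riemann g c [m] [j, k, l] x =
     partial_deriv k (christoffel g c m j l) x - partial_deriv j (christoffel g c m k l) x
     + (\<Sum>p\<in>UNIV. christoffel g c p j l x * christoffel g c m k p x
                 - christoffel g c p k l x * christoffel g c m j p x)"
| "riemann g c _ _ x = 0"

fun ricci :: "('a, 'n::finite) components \<Rightarrow> ('a, 'n) components" where
  "ricci g c [] [k, l] x = - (\<Sum>m\<in>UNIV. riemann g c [m] [m, k, l] x)"
| "ricci g c _ _ x = 0"

fun scalar_curv :: "('a, 'n::finite) components \<Rightarrow> ('a, 'n) components" where
  "scalar_curv g c [] [] x = (\<Sum>i\<in>UNIV. \<Sum>j\<in>UNIV. inv_metric g c i j x * ricci g c [] [i, j] x)"
| "scalar_curv g c _ _ x = 0"

(* (div T)_{ls} = nabla_m T_{ls}^m *)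
definition divergence ::
  "('a, 'n::finite) components \<Rightarrow> ('a, 'n) components \<Rightarrow> ('a, 'n) chart \<Rightarrow> 'n list
     \<Rightarrow> real^'n \<Rightarrow> real" where
  "divergence g T c ls x = (\<Sum>m\<in>UNIV. nabla g T c [m] (m # ls) x)"

definition closed_one_form ::
  "('a, 'n::finite) chart set \<Rightarrow> ('a, 'n) components \<Rightarrow> ('a, 'n) components \<Rightarrow> bool" where
  "closed_one_form \<A> g \<omega> \<longleftrightarrow>
     tensor_field \<A> 0 1 \<omega> \<and>
     (\<forall>c\<in>\<A>. \<forall>x\<in>chart_img c. \<forall>i j. nabla g \<omega> c [] [i, j] x - nabla g \<omega> c [] [j, i] x = 0)"


section \<open>Generalized curvature tensors and weakly Z symmetric manifolds\<close>

definition generalized_curvature_tensor ::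
  "('a, 'n::finite) chart set \<Rightarrow> ('a, 'n) components \<Rightarrow> bool" where
  "generalized_curvature_tensor \<A> K \<longleftrightarrow>
     tensor_field \<A> 1 3 K \<and>
     (\<forall>c\<in>\<A>. \<forall>x\<in>chart_img c. \<forall>j k l m.
        K c [m] [j, k, l] x = - K c [m] [k, j, l] x \<and>
        K c [m] [j, k, l] x + K c [m] [k, l, j] x + K c [m] [l, j, k] x = 0)"

definition harmonic ::
  "('a, 'n::finite) chart set \<Rightarrow> ('a, 'n) components \<Rightarrow> ('a, 'n) components \<Rightarrow> bool" where
  "harmonic \<A> g K \<longleftrightarrow>
     (\<forall>c\<in>\<A>. \<forall>x\<in>chart_img c. \<forall>j k l. divergence g K c [j, k, l] x = 0)"

definition Z_tensor ::
  "('a, 'n::finite) components \<Rightarrow> ('a, 'n) components \<Rightarrow> ('a, 'n) components" where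
  "Z_tensor g \<phi> c us ls x = ricci g c us ls x + \<phi> c [] [] x * g c us ls x"

definition nonsingular ::
  "('a, 'n::finite) chart set \<Rightarrow> ('a, 'n) components \<Rightarrow> bool" where
  "nonsingular \<A> Z \<longleftrightarrow>
     (\<exists>Y. tensor_field \<A> 2 0 Y \<and>
        (\<forall>c\<in>\<A>. \<forall>x\<in>chart_img c. \<forall>h l.
           (\<Sum>k\<in>UNIV. Y c [k, h] [] x * Z c [] [k, l] x) = (if h = l then 1 else 0)))"

(* The (WZS)_n condition for the given scalar function \<phi> and covectors a, b, d. *)
definition weakly_Z_symmetric ::
  "('a, 'n::finite) chart set \<Rightarrow> ('a, 'n) components \<Rightarrow> ('a, 'n) components \<Rightarrow>
   ('a, 'n) components \<Rightarrow> ('a, 'n) components \<Rightarrow> ('a, 'n) components \<Rightarrow> bool" where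
  "weakly_Z_symmetric \<A> g \<phi> a b d \<longleftrightarrow>
     tensor_field \<A> 0 0 \<phi> \<and>
     tensor_field \<A> 0 1 a \<and> tensor_field \<A> 0 1 b \<and> tensor_field \<A> 0 1 d \<and>
     (\<forall>c\<in>\<A>. \<forall>x\<in>chart_img c. \<forall>j k l.
        nabla g (Z_tensor g \<phi>) c [] [k, j, l] x =
          a c [] [k] x * Z_tensor g \<phi> c [] [j, l] x
          + b c [] [j] x * Z_tensor g \<phi> c [] [k, l] x
          + d c [] [l] x * Z_tensor g \<phi> c [] [k, j] x)"

end

theory Submission
  imports Defs
begin

text \<open>With \<open>\<psi> = \<phi> + (B / A) R\<close>, the contracted second Bianchi identity and the hypothesis on
  \<open>K\<close> turn the weak Z symmetry, antisymmetrised in its first two indices, into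
  \<open>\<omega>\<^sub>k Z\<^sub>j\<^sub>l - \<omega>\<^sub>j Z\<^sub>k\<^sub>l = g\<^sub>j\<^sub>l \<nabla>\<^sub>k \<psi> - g\<^sub>k\<^sub>l \<nabla>\<^sub>j \<psi>\<close>; the term in \<open>D\<close> drops out because \<open>Z\<close> is
  symmetric. Differentiating and summing cyclically, everything cancels except
  \<open>(d\<omega>)\<^sub>i\<^sub>k Z\<^sub>j\<^sub>l + (d\<omega>)\<^sub>k\<^sub>j Z\<^sub>i\<^sub>l + (d\<omega>)\<^sub>j\<^sub>i Z\<^sub>k\<^sub>l = 0\<close>, and contracting with the inverse of \<open>Z\<close>
  gives \<open>d\<omega> = 0\<close> as soon as there are three distinct indices.\<close>

section \<open>Partial derivatives\<close>

lemma has_derivative_imp_partial_deriv: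
  "(f has_derivative f') (at x) \<Longrightarrow> partial_deriv k f x = f' (axis k 1)"
  unfolding partial_deriv_def by (metis frechet_derivative_at)

lemma has_derivative_partial_deriv:
  "f differentiable (at x) \<Longrightarrow> (f has_derivative frechet_derivative f (at x)) (at x)"
  by (simp add: frechet_derivative_works)

text \<open>Allows an identity known only on an open set, such as a chart image, to be
  differentiated there.\<close>

lemma partial_deriv_cong:
  assumes "f differentiable (at x)" "open U" "x \<in> U" "\<And>y. y \<in> U \<Longrightarrow> f y = g y"
  shows "partial_deriv k g x = partial_deriv k f x"
  unfolding partial_deriv_def using frechet_derivative_transform_within_open[OF assms] by simp

lemma differentiable_cong_open:
  assumes "f differentiable (at x)" "open U" "x \<in> U" "\<And>y. y \<in> U \<Longrightarrow> f y = g y"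
  shows "g differentiable (at x)"
proof -
  obtain f' where "(f has_derivative f') (at x)"
    using assms(1) unfolding differentiable_def by blast
  from has_derivative_transform_within_open[OF this assms(2-4)] show ?thesis
    unfolding differentiable_def by blast
qed

lemma partial_deriv_const: "partial_deriv k (\<lambda>y. c) x = 0"
  by (simp add: partial_deriv_def)

lemma partial_deriv_add:
  assumes "f differentiable (at x)" "g differentiable (at x)"
  shows "partial_deriv k (\<lambda>y. f y + g y) x = partial_deriv k f x + partial_deriv k g x"
  using has_derivative_imp_partial_deriv[OF has_derivative_add[OF assms[THEN has_derivative_partial_deriv]]]
  by (simp add: partial_deriv_def)

lemma partial_deriv_diff:
  assumes "f differentiable (at x)" "g differentiable (at x)"
  shows "partial_deriv k (\<lambda>y. f y - g y) x = partial_deriv k f x - partial_deriv k g x"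
  using has_derivative_imp_partial_deriv[OF has_derivative_diff[OF assms[THEN has_derivative_partial_deriv]]]
  by (simp add: partial_deriv_def)

lemma partial_deriv_mult:
  assumes "f differentiable (at x)" "g differentiable (at x)"
  shows "partial_deriv k (\<lambda>y. f y * g y) x = partial_deriv k f x * g x + f x * partial_deriv k g x"
  using has_derivative_imp_partial_deriv[OF has_derivative_mult[OF assms[THEN has_derivative_partial_deriv]]]
  by (simp add: partial_deriv_def)

lemma partial_deriv_inverse:
  assumes "f differentiable (at x)" "f x \<noteq> 0"
  shows "partial_deriv k (\<lambda>y. inverse (f y)) x = - (inverse (f x) * partial_deriv k f x * inverse (f x))"
  using has_derivative_imp_partial_deriv[OF
      Deriv.has_derivative_inverse[OF assms(2) assms(1)[THEN has_derivative_partial_deriv]]]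
  by (simp add: partial_deriv_def)

lemma partial_deriv_cdivide:
  "f differentiable (at x) \<Longrightarrow> partial_deriv k (\<lambda>y. f y / r) x = partial_deriv k f x / r"
  using partial_deriv_mult[of f x "\<lambda>y. inverse r" k]
  by (simp add: partial_deriv_const divide_inverse)

lemma partial_deriv_minus:
  "f differentiable (at x) \<Longrightarrow> partial_deriv k (\<lambda>y. - f y) x = - partial_deriv k f x"
  using partial_deriv_diff[of "\<lambda>y. 0" x f k] by (simp add: partial_deriv_const)

lemma partial_deriv_sum:
  assumes "\<And>i. i \<in> I \<Longrightarrow> f i differentiable (at x)"
  shows "partial_deriv k (\<lambda>y. \<Sum>i\<in>I. f i y) x = (\<Sum>i\<in>I. partial_deriv k (f i) x)"
  using has_derivative_imp_partial_deriv[OF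
      has_derivative_sum[OF has_derivative_partial_deriv[OF assms]]]
  by (simp add: partial_deriv_def)

text \<open>The mean value theorem in direction \<open>i\<close> reduces the second difference to a first
  difference of the \<open>i\<close>-th partial derivative, so that only differentiability of the latter
  at the point is needed.\<close>

lemma second_difference_bound:
  fixes f :: "real^'n::finite \<Rightarrow> real"
  assumes U: "open U" "x \<in> U" and f: "\<And>y. y \<in> U \<Longrightarrow> f differentiable (at y)"
    and D: "partial_deriv i f differentiable (at x)" and e: "0 < e"
  shows "\<exists>d>0. \<forall>t. 0 < t \<and> t < d \<longrightarrow>
     \<bar>f (x + t *\<^sub>R axis i 1 + t *\<^sub>R axis j 1) - f (x + t *\<^sub>R axis i 1) - f (x + t *\<^sub>R axis j 1) + f x
        - t\<^sup>2 * partial_deriv j (partial_deriv i f) x\<bar> \<le> 3 * e * t\<^sup>2"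
proof -
  let ?u = "axis i 1 :: real^'n" and ?v = "axis j 1 :: real^'n"
  let ?P = "partial_deriv i f" and ?L = "frechet_derivative (partial_deriv i f) (at x)"
  have L: "(?P has_derivative ?L) (at x)"
    using D by (rule has_derivative_partial_deriv)
  interpret L: bounded_linear ?L
    using L by (rule has_derivative_bounded_linear)
  obtain d1 where d1: "d1 > 0" "\<And>y. norm (y - x) < d1 \<Longrightarrow> \<bar>?P y - ?P x - ?L (y - x)\<bar> \<le> e * norm (y - x)"
    using L e unfolding has_derivative_at_alt real_norm_def by blast
  obtain d2 where d2: "d2 > 0" "ball x d2 \<subseteq> U"
    using U openE by blast
  \<comment> \<open>Half of \<open>min d1 d2\<close> is taken because the corner
    \<open>x + s *\<^sub>R ?u + t *\<^sub>R ?v\<close> may be as far as \<open>2 * t\<close> from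
    \<open>x\<close>.\<close>
  have main: "\<bar>f (x + t *\<^sub>R ?u + t *\<^sub>R ?v) - f (x + t *\<^sub>R ?u) - f (x + t *\<^sub>R ?v) + f x
        - t\<^sup>2 * partial_deriv j ?P x\<bar> \<le> 3 * e * t\<^sup>2"
    if t: "0 < t" "t < min d1 d2 / 2" for t
  proof -
    have nu: "norm (s *\<^sub>R ?u) \<le> t" if "0 \<le> s" "s \<le> t" for s
      using that by simp
    have nuv: "norm (s *\<^sub>R ?u + t *\<^sub>R ?v) \<le> 2 * t" if "0 \<le> s" "s \<le> t" for s
      using norm_triangle_ineq[of "s *\<^sub>R ?u" "t *\<^sub>R ?v"] that t by simp
    have inU: "x + s *\<^sub>R ?u \<in> U" "x + s *\<^sub>R ?u + t *\<^sub>R ?v \<in> U" if "0 \<le> s" "s \<le> t" for s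
    proof -
      have "dist (x + s *\<^sub>R ?u) x < d2" "dist (x + (s *\<^sub>R ?u + t *\<^sub>R ?v)) x < d2"
        using nu[OF that] nuv[OF that] t by (auto simp: dist_norm simp del: norm_scaleR)
      then show "x + s *\<^sub>R ?u \<in> U" "x + s *\<^sub>R ?u + t *\<^sub>R ?v \<in> U"
        using d2(2) by (auto simp: add.assoc dist_commute)
    qed
    let ?F = "\<lambda>s. f (x + s *\<^sub>R ?u + t *\<^sub>R ?v) - f (x + s *\<^sub>R ?u)"
    have "\<exists>s\<in>{0<..<t}. ?F t - ?F 0 =
        (\<lambda>h. h * (?P (x + s *\<^sub>R ?u + t *\<^sub>R ?v) - ?P (x + s *\<^sub>R ?u))) (t - 0)"
    proof (rule mvt_simple[where f = ?F], fact t(1))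
      fix s assume s: "0 \<le> s" "s \<le> t"
      have lin: "frechet_derivative f (at z) (h *\<^sub>R ?u) = h * ?P z" if "z \<in> U" for z h
        using linear_scale[OF linear_frechet_derivative[OF f[OF that]]]
        by (simp add: partial_deriv_def)
      have c1: "((\<lambda>s. x + s *\<^sub>R ?u + t *\<^sub>R ?v) has_derivative (\<lambda>h. h *\<^sub>R ?u)) (at s within {0..t})"
        and c2: "((\<lambda>s. x + s *\<^sub>R ?u) has_derivative (\<lambda>h. h *\<^sub>R ?u)) (at s within {0..t})"
        by (auto intro!: derivative_eq_intros)
      show "(?F has_derivative (\<lambda>h. h * (?P (x + s *\<^sub>R ?u + t *\<^sub>R ?v) - ?P (x + s *\<^sub>R ?u))))
          (at s within {0..t})"
        using has_derivative_diff[OF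
           has_derivative_compose[OF c1 has_derivative_partial_deriv[OF f[OF inU(2)[OF s]]]]
           has_derivative_compose[OF c2 has_derivative_partial_deriv[OF f[OF inU(1)[OF s]]]]]
        by (simp add: lin[OF inU(1)[OF s]] lin[OF inU(2)[OF s]] right_diff_distrib)
    qed
    then obtain s where s: "0 < s" "s < t" and eq: "?F t - ?F 0 =
        t * (?P (x + s *\<^sub>R ?u + t *\<^sub>R ?v) - ?P (x + s *\<^sub>R ?u))"
      by auto
    have s': "0 \<le> s" "s \<le> t" using s by auto
    have b1: "\<bar>?P (x + s *\<^sub>R ?u + t *\<^sub>R ?v) - ?P x - ?L (s *\<^sub>R ?u + t *\<^sub>R ?v)\<bar> \<le> e * (2 * t)"
    proof -
      have "norm (x + s *\<^sub>R ?u + t *\<^sub>R ?v - x) \<le> 2 * t"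
        using nuv[OF s'] by (simp add: add.assoc)
      moreover from this have "norm (x + s *\<^sub>R ?u + t *\<^sub>R ?v - x) < d1"
        using t by linarith
      ultimately show ?thesis
        using order_trans[OF d1(2)[of "x + s *\<^sub>R ?u + t *\<^sub>R ?v"] mult_left_mono[of _ "2 * t" e]] e
        by (simp add: add.assoc)
    qed
    have b2: "\<bar>?P (x + s *\<^sub>R ?u) - ?P x - ?L (s *\<^sub>R ?u)\<bar> \<le> e * t"
      using order_trans[OF d1(2)[of "x + s *\<^sub>R ?u"] mult_left_mono[of _ t e]] s t e by simp
    have "?L (s *\<^sub>R ?u + t *\<^sub>R ?v) - ?L (s *\<^sub>R ?u) = t * partial_deriv j ?P x"
      by (simp add: L.add L.scaleR partial_deriv_def[of j])
    \<comment> \<open>The errors \<open>2 * e * t\<close> from \<open>b1\<close> and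
      \<open>e * t\<close> from \<open>b2\<close> add up to the constant 3.\<close>
    then have "\<bar>(?P (x + s *\<^sub>R ?u + t *\<^sub>R ?v) - ?P (x + s *\<^sub>R ?u)) - t * partial_deriv j ?P x\<bar> \<le> 3 * e * t"
      using b1 b2 by (simp add: algebra_simps)
    then have "t * \<bar>(?P (x + s *\<^sub>R ?u + t *\<^sub>R ?v) - ?P (x + s *\<^sub>R ?u)) - t * partial_deriv j ?P x\<bar> \<le> t * (3 * e * t)"
      using t by simp
    then have "\<bar>t * ((?P (x + s *\<^sub>R ?u + t *\<^sub>R ?v) - ?P (x + s *\<^sub>R ?u)) - t * partial_deriv j ?P x)\<bar> \<le> t * (3 * e * t)"
      using t by (simp add: abs_mult)
    then have "\<bar>?F t - ?F 0 - t\<^sup>2 * partial_deriv j ?P x\<bar> \<le> 3 * e * t\<^sup>2"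
      unfolding eq by (simp add: right_diff_distrib power2_eq_square mult_ac)
    then show ?thesis by simp
  qed
  have "min d1 d2 / 2 > 0" using d1 d2 by simp
  then show ?thesis using main by blast
qed

text \<open>The second difference is symmetric in \<open>i\<close> and \<open>j\<close>, so for
  small \<open>t\<close> its quotient by \<open>t\<^sup>2\<close> lies within \<open>3 * e\<close>
  of both mixed derivatives.\<close>

lemma partial_deriv_commute:
  fixes f :: "real^'n::finite \<Rightarrow> real"
  assumes U: "open U" "x \<in> U" and f: "\<And>y. y \<in> U \<Longrightarrow> f differentiable (at y)"
    and D: "\<And>k. partial_deriv k f differentiable (at x)"
  shows "partial_deriv i (partial_deriv j f) x = partial_deriv j (partial_deriv i f) x"
proof (rule ccontr)
  let ?a = "partial_deriv i (partial_deriv j f) x" and ?b = "partial_deriv j (partial_deriv i f) x"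
  assume ne: "?a \<noteq> ?b"
  \<comment> \<open>With this choice the bound \<open>6 * e\<close> obtained below is half of the
    distance between the two values, a contradiction.\<close>
  define e where "e = \<bar>?a - ?b\<bar> / 12"
  have e: "e > 0" using ne by (simp add: e_def)
  obtain d1 where d1: "d1 > 0" "\<forall>t. 0 < t \<and> t < d1 \<longrightarrow>
     \<bar>f (x + t *\<^sub>R axis i 1 + t *\<^sub>R axis j 1) - f (x + t *\<^sub>R axis i 1) - f (x + t *\<^sub>R axis j 1) + f x
        - t\<^sup>2 * ?b\<bar> \<le> 3 * e * t\<^sup>2"
    using second_difference_bound[OF U f D e] by blast
  obtain d2 where d2: "d2 > 0" "\<forall>t. 0 < t \<and> t < d2 \<longrightarrow>
     \<bar>f (x + t *\<^sub>R axis j 1 + t *\<^sub>R axis i 1) - f (x + t *\<^sub>R axis j 1) - f (x + t *\<^sub>R axis i 1) + f x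
        - t\<^sup>2 * ?a\<bar> \<le> 3 * e * t\<^sup>2"
    using second_difference_bound[OF U f D e] by blast
  define t where "t = min d1 d2 / 2"
  have t: "0 < t" "t < d1" "t < d2" using d1 d2 by (auto simp: t_def)
  have "\<bar>t\<^sup>2 * ?a - t\<^sup>2 * ?b\<bar> \<le> 6 * e * t\<^sup>2"
    using d1(2)[rule_format, of t] d2(2)[rule_format, of t] t by (simp add: add_ac)
  then have "t\<^sup>2 * \<bar>?a - ?b\<bar> \<le> t\<^sup>2 * (6 * e)"
    by (simp add: right_diff_distrib[symmetric] abs_mult mult_ac)
  then have "\<bar>?a - ?b\<bar> \<le> 6 * e" using t by simp
  then show False using e by (simp add: e_def)
qed

section \<open>Closure properties of smooth functions\<close>

text \<open>\<open>iter_partial\<close> adds derivatives on the outside; this recursion peels off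
  the innermost one, so that the sum, product and quotient rules apply in an induction on the
  order.\<close>

fun diff_order :: "nat \<Rightarrow> (real^'n::finite) set \<Rightarrow> (real^'n \<Rightarrow> real) \<Rightarrow> bool" where
  "diff_order 0 U f \<longleftrightarrow> True"
| "diff_order (Suc m) U f \<longleftrightarrow>
     (\<forall>x\<in>U. f differentiable (at x)) \<and> (\<forall>k. diff_order m U (partial_deriv k f))"

lemma iter_partial_append:
  fixes f :: "real^'n::finite \<Rightarrow> real"
  shows "iter_partial (ks @ [k]) f = iter_partial ks (partial_deriv k f)"
  by (induction ks) auto

text \<open>The bound on the length is strict: order 1 concerns only the empty list, that is,
  differentiability of \<open>f\<close> itself.\<close>

lemma diff_order_iff:
  fixes f :: "real^'n::finite \<Rightarrow> real"
  shows "diff_order m U f \<longleftrightarrow> (\<forall>ks. length ks < m \<longrightarrow> (\<forall>x\<in>U. iter_partial ks f differentiable (at x)))"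
proof (induction m arbitrary: f)
  case (Suc m)
  show ?case
  proof (intro iffI allI impI ballI)
    fix ks :: "'n list" and x
    assume *: "diff_order (Suc m) U f" "length ks < Suc m" "x \<in> U"
    show "iter_partial ks f differentiable (at x)"
    proof (cases ks rule: rev_cases)
      case (snoc js k)
      then show ?thesis using * Suc by (simp add: iter_partial_append)
    qed (use * in simp)
  next
    assume *: "\<forall>ks. length ks < Suc m \<longrightarrow> (\<forall>x\<in>U. iter_partial ks f differentiable (at x))"
    have "f differentiable (at x)" if "x \<in> U" for x
      using *[rule_format, of "[]"] that by simp
    moreover have "diff_order m U (partial_deriv k f)" for k
      unfolding Suc using * by (auto simp: iter_partial_append[symmetric])
    ultimately show "diff_order (Suc m) U f" by simp
  qed
qed simp

lemma smooth_fun_on_iff: "smooth_fun_on U f \<longleftrightarrow> (\<forall>m. diff_order m U f)"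
  unfolding smooth_fun_on_def diff_order_iff by blast

lemma smooth_imp_differentiable: "smooth_fun_on U f \<Longrightarrow> x \<in> U \<Longrightarrow> f differentiable (at x)"
  unfolding smooth_fun_on_def by (metis iter_partial.simps(1))

lemma smooth_partial_deriv: "smooth_fun_on U f \<Longrightarrow> smooth_fun_on U (partial_deriv k f)"
  unfolding smooth_fun_on_def by (metis iter_partial_append)

lemma diff_order_mono: "diff_order (Suc m) U f \<Longrightarrow> diff_order m U f"
  unfolding diff_order_iff by auto

lemma diff_order_cong:
  assumes "open U" "diff_order m U f" "\<And>y. y \<in> U \<Longrightarrow> f y = g y"
  shows "diff_order m U g"
  using assms(2,3)
proof (induction m arbitrary: f g)
  case (Suc m)
  have d: "f differentiable (at x)" if "x \<in> U" for x
    using Suc.prems(1) that by simp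
  have "diff_order m U (partial_deriv k g)" for k
  proof (rule Suc.IH)
    show "diff_order m U (partial_deriv k f)"
      using Suc.prems(1) by simp
    show "partial_deriv k f y = partial_deriv k g y" if "y \<in> U" for y
      using partial_deriv_cong[OF d[OF that] assms(1) that Suc.prems(2)] by simp
  qed
  moreover have "g differentiable (at x)" if "x \<in> U" for x
    using differentiable_cong_open[OF d[OF that] assms(1) that Suc.prems(2)] .
  ultimately show ?case by simp
qed simp

lemma diff_order_const: "diff_order m U (\<lambda>y. c)"
proof (induction m arbitrary: c)
  case (Suc m)
  have "partial_deriv k (\<lambda>y. c) = (\<lambda>y. 0)" for k :: 'a
    by (simp add: partial_deriv_const fun_eq_iff)
  then show ?case using Suc by simp
qed simp

lemma diff_order_add:
  assumes "open U"
  shows "diff_order m U f \<Longrightarrow> diff_order m U g \<Longrightarrow> diff_order m U (\<lambda>y. f y + g y)"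
proof (induction m arbitrary: f g)
  case (Suc m)
  have "diff_order m U (partial_deriv k (\<lambda>y. f y + g y))" for k
    by (rule diff_order_cong[OF assms, where f = "\<lambda>y. partial_deriv k f y + partial_deriv k g y"])
      (use Suc in \<open>auto simp: partial_deriv_add\<close>)
  then show ?case using Suc.prems by (auto intro: differentiable_add)
qed simp

text \<open>In the product rule each summand pairs a derivative with an undifferentiated factor; the
  latter is lowered by one order before the induction hypothesis applies.\<close>

lemma diff_order_mult:
  assumes "open U"
  shows "diff_order m U f \<Longrightarrow> diff_order m U g \<Longrightarrow> diff_order m U (\<lambda>y. f y * g y)"
proof (induction m arbitrary: f g)
  case (Suc m)
  have "diff_order m U (partial_deriv k (\<lambda>y. f y * g y))" for k
    by (rule diff_order_cong[OF assms,
          where f = "\<lambda>y. partial_deriv k f y * g y + f y * partial_deriv k g y"])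
      (use Suc diff_order_mono[OF Suc.prems(1)] diff_order_mono[OF Suc.prems(2)] in
        \<open>auto simp: partial_deriv_mult intro!: diff_order_add assms\<close>)
  then show ?case using Suc.prems by (auto intro: differentiable_mult)
qed simp

text \<open>The derivative of \<open>1/f\<close> contains \<open>1/f\<close> again, but only to one
  order less, so the induction closes with \<open>f\<close> fixed.\<close>

lemma diff_order_inverse:
  assumes "open U" "\<And>y. y \<in> U \<Longrightarrow> f y \<noteq> 0"
  shows "diff_order m U f \<Longrightarrow> diff_order m U (\<lambda>y. inverse (f y))"
proof (induction m)
  case (Suc m)
  have inv: "diff_order m U (\<lambda>y. inverse (f y))"
    using Suc.IH diff_order_mono[OF Suc.prems] by blast
  have "diff_order m U (\<lambda>y. (-1) * (inverse (f y) * partial_deriv k f y * inverse (f y)))" for k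
    using Suc.prems inv by (intro diff_order_mult diff_order_const assms(1)) simp_all
  then have "diff_order m U (partial_deriv k (\<lambda>y. inverse (f y)))" for k
    by (rule diff_order_cong[OF assms(1)])
      (use Suc.prems assms(2) in \<open>auto simp: partial_deriv_inverse\<close>)
  then show ?case using Suc.prems assms(2) by (auto intro: differentiable_inverse)
qed simp

lemma smooth_const: "smooth_fun_on U (\<lambda>y. c)"
  by (simp add: smooth_fun_on_iff diff_order_const)

lemma smooth_add:
  "open U \<Longrightarrow> smooth_fun_on U f \<Longrightarrow> smooth_fun_on U g \<Longrightarrow> smooth_fun_on U (\<lambda>y. f y + g y)"
  by (simp add: smooth_fun_on_iff diff_order_add)

lemma smooth_mult:
  "open U \<Longrightarrow> smooth_fun_on U f \<Longrightarrow> smooth_fun_on U g \<Longrightarrow> smooth_fun_on U (\<lambda>y. f y * g y)"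
  by (simp add: smooth_fun_on_iff diff_order_mult)

lemma smooth_inverse:
  "open U \<Longrightarrow> (\<And>y. y \<in> U \<Longrightarrow> f y \<noteq> 0) \<Longrightarrow> smooth_fun_on U f \<Longrightarrow> smooth_fun_on U (\<lambda>y. inverse (f y))"
  by (simp add: smooth_fun_on_iff diff_order_inverse)

lemma smooth_cong:
  "open U \<Longrightarrow> smooth_fun_on U f \<Longrightarrow> (\<And>y. y \<in> U \<Longrightarrow> f y = g y) \<Longrightarrow> smooth_fun_on U g"
  unfolding smooth_fun_on_iff using diff_order_cong by blast

lemma smooth_minus: "open U \<Longrightarrow> smooth_fun_on U f \<Longrightarrow> smooth_fun_on U (\<lambda>y. - f y)"
  using smooth_mult[OF _ smooth_const[of U "-1"]] by simp

lemma smooth_diff: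
  "open U \<Longrightarrow> smooth_fun_on U f \<Longrightarrow> smooth_fun_on U g \<Longrightarrow> smooth_fun_on U (\<lambda>y. f y - g y)"
  using smooth_add[OF _ _ smooth_minus, of U f g] by simp

lemma smooth_sum:
  "open U \<Longrightarrow> (\<And>i. i \<in> I \<Longrightarrow> smooth_fun_on U (f i)) \<Longrightarrow> smooth_fun_on U (\<lambda>y. \<Sum>i\<in>I. f i y)"
  by (induction I rule: infinite_finite_induct) (auto intro: smooth_add smooth_const)

lemma smooth_prod:
  "open U \<Longrightarrow> (\<And>i. i \<in> I \<Longrightarrow> smooth_fun_on U (f i)) \<Longrightarrow> smooth_fun_on U (\<lambda>y. \<Prod>i\<in>I. f i y)"
  by (induction I rule: infinite_finite_induct) (auto intro: smooth_mult smooth_const)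

lemmas smooth_intros = smooth_const smooth_add smooth_mult smooth_diff smooth_minus smooth_sum
  smooth_prod smooth_partial_deriv

lemma smooth_partial_deriv_commute:
  assumes "open U" "smooth_fun_on U f" "x \<in> U"
  shows "partial_deriv i (partial_deriv j f) x = partial_deriv j (partial_deriv i f) x"
  using assms by (meson partial_deriv_commute smooth_imp_differentiable smooth_partial_deriv)

section \<open>Inverse matrices with smooth entries\<close>

lemma matrix_inv_inverse:
  assumes "invertible A"
  shows "A ** matrix_inv A = mat 1" "matrix_inv A ** A = mat 1"
  using someI_ex[OF assms[unfolded invertible_def]] unfolding matrix_inv_def by auto

text \<open>By Cramer's rule an entry of the inverse is a quotient of determinants, and a
  determinant is a polynomial in the entries.\<close>

lemma smooth_matrix_inv:
  fixes G :: "real^'n::finite \<Rightarrow> real^'n^'n"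
  assumes "open U" "\<And>i j. smooth_fun_on U (\<lambda>y. G y $ i $ j)" "\<And>y. y \<in> U \<Longrightarrow> invertible (G y)"
  shows "smooth_fun_on U (\<lambda>y. matrix_inv (G y) $ i $ j)"
proof (rule smooth_cong[OF assms(1), where
      f = "\<lambda>y. det (\<chi> p q. if q = i then axis j 1 $ p else G y $ p $ q) * inverse (det (G y))"])
  fix y assume "y \<in> U"
  then have inv: "invertible (G y)" by (rule assms(3))
  then have d: "det (G y) \<noteq> 0" by (simp add: invertible_det_nz)
  \<comment> \<open>Column \<open>j\<close> of the inverse solves the linear system with right-hand
    side \<open>axis j 1\<close>.\<close>
  have "G y *v (matrix_inv (G y) *v axis j 1) = axis j 1"
    using inv by (simp add: matrix_vector_mul_assoc matrix_inv_inverse)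
  then have "matrix_inv (G y) *v axis j 1 =
      (\<chi> k. det (\<chi> p q. if q = k then axis j 1 $ p else G y $ p $ q) / det (G y))"
    using cramer[OF d] by blast
  then show "det (\<chi> p q. if q = i then axis j 1 $ p else G y $ p $ q) * inverse (det (G y)) =
      matrix_inv (G y) $ i $ j"
    by (simp add: matrix_vector_mult_basis column_def vec_eq_iff divide_inverse)
next
  have det: "smooth_fun_on U (\<lambda>y. det (F y))"
    if "\<And>i j. smooth_fun_on U (\<lambda>y. F y $ i $ j)" for F :: "real^'n \<Rightarrow> real^'n^'n"
    unfolding det_def using that by (intro smooth_intros assms(1)) auto
  have "smooth_fun_on U (\<lambda>y. (\<chi> p q. if q = i then axis j 1 $ p else G y $ p $ q) $ k $ l)" for k l
    using assms(2) by (cases "l = i") (auto intro: smooth_const)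
  then show "smooth_fun_on U (\<lambda>y. det (\<chi> p q. if q = i then axis j 1 $ p else G y $ p $ q)
      * inverse (det (G y)))"
    using assms det by (intro smooth_mult smooth_inverse) (auto simp: invertible_det_nz)
qed

section \<open>The Levi-Civita connection in a chart\<close>

text \<open>Isolates what a Riemannian metric provides in one chart, so that all tensor calculus
  below is about components on an open subset of Euclidean space.\<close>

locale metric_chart =
  fixes g :: "('a, 'n::finite) components" and c :: "('a, 'n) chart"
  assumes open_img: "open (chart_img c)"
    and smooth_metric: "smooth_fun_on (chart_img c) (g c [] [i, j])"
    and metric_sym: "x \<in> chart_img c \<Longrightarrow> g c [] [i, j] x = g c [] [j, i] x"
    and metric_pos: "x \<in> chart_img c \<Longrightarrow> v \<noteq> 0 \<Longrightarrow>
      (\<Sum>i\<in>UNIV. \<Sum>j\<in>UNIV. g c [] [i, j] x * v $ i * v $ j) > 0"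
begin

abbreviation U where "U \<equiv> chart_img c"
abbreviation G where "G i j \<equiv> g c [] [i, j]"
abbreviation H where "H i j \<equiv> inv_metric g c i j"
abbreviation Gam where "Gam m i j \<equiv> christoffel g c m i j"
abbreviation Rm where "Rm j k l m \<equiv> riemann g c [m] [j, k, l]"
abbreviation Rc where "Rc k l \<equiv> ricci g c [] [k, l]"

text \<open>A vector in the kernel would make the positive definite quadratic form vanish.\<close>

lemma invertible_metric:
  assumes x: "x \<in> U"
  shows "invertible (\<chi> p q. G p q x)"
  unfolding invertible_left_inverse matrix_left_invertible_ker
proof (intro allI impI)
  fix v :: "real^'n" assume *: "(\<chi> p q. G p q x) *v v = 0"
  have "(\<Sum>i\<in>UNIV. \<Sum>j\<in>UNIV. G i j x * v $ i * v $ j) = (\<Sum>i\<in>UNIV. v $ i * (\<Sum>j\<in>UNIV. G i j x * v $ j))"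
    by (simp add: sum_distrib_left mult_ac)
  also have "\<dots> = 0"
    using * by (simp add: vec_eq_iff matrix_vector_mult_def)
  finally show "v = 0"
    using metric_pos[OF x, of v] by force
qed

lemma inv_metric_right: "x \<in> U \<Longrightarrow> (\<Sum>p\<in>UNIV. G i p x * H p j x) = of_bool (i = j)"
  using arg_cong[OF matrix_inv_inverse(1)[OF invertible_metric], of x "\<lambda>M. M $ i $ j"]
  by (simp add: matrix_matrix_mult_def inv_metric_def mat_def)

lemma inv_metric_left: "x \<in> U \<Longrightarrow> (\<Sum>p\<in>UNIV. H i p x * G p j x) = of_bool (i = j)"
  using arg_cong[OF matrix_inv_inverse(2)[OF invertible_metric], of x "\<lambda>M. M $ i $ j"]
  by (simp add: matrix_matrix_mult_def inv_metric_def mat_def)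

text \<open>Inserting the identity as \<open>H\<close> times \<open>G\<close> and using the symmetry
  of \<open>G\<close> lets the other copy of \<open>H\<close> be cancelled instead.\<close>

lemma inv_metric_sym:
  assumes x: "x \<in> U"
  shows "H i j x = H j i x"
proof -
  have "H i j x = (\<Sum>q\<in>UNIV. H i q x * of_bool (j = q))"
    by simp
  also have "\<dots> = (\<Sum>q\<in>UNIV. H i q x * (\<Sum>p\<in>UNIV. H j p x * G p q x))"
    by (simp only: inv_metric_left[OF x])
  also have "\<dots> = (\<Sum>q\<in>UNIV. \<Sum>p\<in>UNIV. H j p x * (H i q x * G q p x))"
    by (simp add: sum_distrib_left mult_ac metric_sym[OF x])
  also have "\<dots> = (\<Sum>p\<in>UNIV. H j p x * (\<Sum>q\<in>UNIV. H i q x * G q p x))"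
    unfolding sum_distrib_left by (rule sum.swap)
  also have "\<dots> = H j i x"
    by (simp add: inv_metric_left[OF x])
  finally show ?thesis .
qed

section \<open>Smoothness of the inverse metric, the connection and the curvature\<close>

lemma smooth_inv_metric: "smooth_fun_on U (H i j)"
proof -
  have "smooth_fun_on U (\<lambda>y. matrix_inv (\<chi> p q. G p q y) $ i $ j)"
    by (rule smooth_matrix_inv[OF open_img]) (simp_all add: smooth_metric invertible_metric)
  then show ?thesis
    unfolding inv_metric_def[symmetric] .
qed

lemma smooth_christoffel: "smooth_fun_on U (Gam m i j)"
proof -
  have "smooth_fun_on U (\<lambda>x. (\<Sum>p\<in>UNIV. H m p x *
        (partial_deriv i (G p j) x + partial_deriv j (G i p) x - partial_deriv p (G i j) x)) * (1/2))"
    by (intro smooth_intros open_img smooth_metric smooth_inv_metric)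
  then show ?thesis
    by (simp add: christoffel_def[abs_def])
qed

text \<open>The defining equation needs a point as argument; this form can be used under
  \<open>partial_deriv\<close> and \<open>smooth_fun_on\<close>.\<close>

lemma riemann_fun:
  "Rm j k l m = (\<lambda>x. partial_deriv k (Gam m j l) x - partial_deriv j (Gam m k l) x
     + (\<Sum>p\<in>UNIV. Gam p j l x * Gam m k p x - Gam p k l x * Gam m j p x))"
  by (rule ext) simp

lemma ricci_fun: "Rc k l = (\<lambda>x. - (\<Sum>m\<in>UNIV. Rm m k l m x))"
  by (rule ext) (simp del: riemann.simps)

lemma smooth_riemann: "smooth_fun_on U (Rm j k l m)"
  unfolding riemann_fun by (intro smooth_intros open_img smooth_christoffel)

lemma smooth_ricci: "smooth_fun_on U (Rc k l)"
  unfolding ricci_fun by (intro smooth_intros open_img smooth_riemann)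

lemma smooth_scalar_curv: "smooth_fun_on U (scalar_curv g c [] [])"
proof -
  have "scalar_curv g c [] [] = (\<lambda>x. \<Sum>i\<in>UNIV. \<Sum>j\<in>UNIV. H i j x * Rc i j x)"
    by (rule ext) (simp del: ricci.simps)
  then show ?thesis
    by (simp only:) (intro smooth_intros open_img smooth_inv_metric smooth_ricci)
qed

lemmas diffs = smooth_metric[THEN smooth_imp_differentiable]
  smooth_metric[THEN smooth_partial_deriv, THEN smooth_imp_differentiable]
  smooth_inv_metric[THEN smooth_imp_differentiable]
  smooth_christoffel[THEN smooth_imp_differentiable]
  smooth_christoffel[THEN smooth_partial_deriv, THEN smooth_imp_differentiable]
  smooth_riemann[THEN smooth_imp_differentiable]
  smooth_ricci[THEN smooth_imp_differentiable]

section \<open>Symmetry of the Christoffel symbols and compatibility with the metric\<close>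

lemma partial_deriv_metric_sym:
  "x \<in> U \<Longrightarrow> partial_deriv k (G i j) x = partial_deriv k (G j i) x"
  by (rule partial_deriv_cong[OF _ open_img]) (auto simp: diffs metric_sym)

lemma christoffel_sym:
  assumes x: "x \<in> U"
  shows "Gam m i j x = Gam m j i x"
proof -
  have "partial_deriv i (G p j) x + partial_deriv j (G i p) x - partial_deriv p (G i j) x =
      partial_deriv j (G p i) x + partial_deriv i (G j p) x - partial_deriv p (G j i) x" for p
    using partial_deriv_metric_sym[OF x, of i p j] partial_deriv_metric_sym[OF x, of j i p]
      partial_deriv_metric_sym[OF x, of p i j] by simp
  then show ?thesis
    unfolding christoffel_def by simp
qed

lemma partial_deriv_christoffel_sym:
  "x \<in> U \<Longrightarrow> partial_deriv k (Gam m i j) x = partial_deriv k (Gam m j i) x"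
  by (rule partial_deriv_cong[OF _ open_img]) (auto simp: diffs christoffel_sym)

lemma lower_christoffel:
  assumes x: "x \<in> U"
  shows "(\<Sum>m\<in>UNIV. G q m x * Gam m i j x) =
    (partial_deriv i (G q j) x + partial_deriv j (G i q) x - partial_deriv q (G i j) x) / 2"
proof -
  define E where "E p = (partial_deriv i (G p j) x + partial_deriv j (G i p) x - partial_deriv p (G i j) x) / 2" for p
  have "(\<Sum>m\<in>UNIV. G q m x * Gam m i j x) = (\<Sum>m\<in>UNIV. \<Sum>p\<in>UNIV. G q m x * H m p x * E p)"
    by (simp add: christoffel_def E_def sum_distrib_left sum_divide_distrib mult_ac)
  also have "\<dots> = (\<Sum>p\<in>UNIV. (\<Sum>m\<in>UNIV. G q m x * H m p x) * E p)"
    unfolding sum_distrib_right by (rule sum.swap)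
  also have "\<dots> = E q"
    by (simp add: inv_metric_right[OF x])
  finally show ?thesis
    unfolding E_def .
qed

text \<open>This is the vanishing of the covariant derivative of \<open>g\<close>. Of the six half
  derivatives of the metric that arise on lowering, four cancel in pairs and two add up.\<close>

lemma metric_compatible:
  assumes x: "x \<in> U"
  shows "partial_deriv k (G i j) x = (\<Sum>p\<in>UNIV. Gam p k i x * G p j x) + (\<Sum>p\<in>UNIV. Gam p k j x * G i p x)"
proof -
  have 1: "(\<Sum>p\<in>UNIV. Gam p k i x * G p j x) = (\<Sum>p\<in>UNIV. G j p x * Gam p k i x)"
    by (simp add: mult.commute metric_sym[OF x, of _ j])
  have 2: "(\<Sum>p\<in>UNIV. Gam p k j x * G i p x) = (\<Sum>p\<in>UNIV. G i p x * Gam p k j x)"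
    by (simp add: mult.commute)
  show ?thesis
    unfolding 1 2 lower_christoffel[OF x]
    using partial_deriv_metric_sym[OF x, of k i j] partial_deriv_metric_sym[OF x, of i k j]
      partial_deriv_metric_sym[OF x, of j k i] by (simp add: field_simps)
qed

text \<open>Differentiate the identity \<open>H\<close> times \<open>G\<close> equals 1 and multiply
  by \<open>H\<close> from the right.\<close>

lemma partial_deriv_inv_metric:
  assumes x: "x \<in> U"
  shows "partial_deriv k (H i j) x =
    - (\<Sum>a\<in>UNIV. \<Sum>b\<in>UNIV. H i a x * partial_deriv k (G a b) x * H b j x)"
proof -
  have 1: "(\<Sum>p\<in>UNIV. partial_deriv k (H i p) x * G p q x) = - (\<Sum>p\<in>UNIV. H i p x * partial_deriv k (G p q) x)" for q
  proof -
    have "partial_deriv k (\<lambda>y. \<Sum>p\<in>UNIV. H i p y * G p q y) x = partial_deriv k (\<lambda>y. of_bool (i = q)) x"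
      by (rule partial_deriv_cong[OF _ open_img x]) (simp_all add: inv_metric_left)
    then show ?thesis
      by (simp add: partial_deriv_const partial_deriv_sum partial_deriv_mult diffs x sum.distrib eq_neg_iff_add_eq_0)
  qed
  have "partial_deriv k (H i j) x = (\<Sum>p\<in>UNIV. partial_deriv k (H i p) x * (\<Sum>q\<in>UNIV. G p q x * H q j x))"
    by (simp add: inv_metric_right[OF x])
  also have "\<dots> = (\<Sum>q\<in>UNIV. (\<Sum>p\<in>UNIV. partial_deriv k (H i p) x * G p q x) * H q j x)"
    unfolding sum_distrib_left sum_distrib_right mult.assoc by (rule sum.swap)
  also have "\<dots> = - (\<Sum>b\<in>UNIV. \<Sum>a\<in>UNIV. H i a x * partial_deriv k (G a b) x * H b j x)"
    by (simp add: 1 sum_distrib_right sum_negf)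
  finally show ?thesis
    using sum.swap[of "\<lambda>b a. H i a x * partial_deriv k (G a b) x * H b j x" UNIV UNIV] by simp
qed

text \<open>Contracted with the symmetric \<open>H\<close>, the other two metric derivatives in the
  Christoffel symbol cancel.\<close>

lemma christoffel_trace:
  assumes x: "x \<in> U"
  shows "(\<Sum>m\<in>UNIV. Gam m k m x) = (\<Sum>m\<in>UNIV. \<Sum>p\<in>UNIV. H m p x * partial_deriv k (G p m) x) / 2"
proof -
  have "(\<Sum>m\<in>UNIV. \<Sum>p\<in>UNIV. H m p x * partial_deriv m (G k p) x) =
      (\<Sum>p\<in>UNIV. \<Sum>m\<in>UNIV. H m p x * partial_deriv m (G k p) x)"
    by (rule sum.swap)
  also have "\<dots> = (\<Sum>m\<in>UNIV. \<Sum>p\<in>UNIV. H m p x * partial_deriv p (G k m) x)"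
    by (simp add: inv_metric_sym[OF x])
  finally have *: "(\<Sum>m\<in>UNIV. \<Sum>p\<in>UNIV. H m p x * partial_deriv m (G k p) x) =
     (\<Sum>m\<in>UNIV. \<Sum>p\<in>UNIV. H m p x * partial_deriv p (G k m) x)" .
  show ?thesis
    unfolding christoffel_def
    by (simp add: sum_divide_distrib[symmetric] distrib_left right_diff_distrib sum.distrib
        sum_subtractf *)
qed

text \<open>The trace \<open>\<Gamma>\<^sup>m\<^sub>k\<^sub>m\<close> is the \<open>k\<close>-th derivative of \<open>ln (sqrt (det g))\<close>; its curl vanishes,
  and this is what makes the Ricci tensor symmetric.\<close>

lemma christoffel_trace_closed:
  assumes x: "x \<in> U"
  shows "(\<Sum>m\<in>UNIV. partial_deriv l (Gam m k m) x) = (\<Sum>m\<in>UNIV. partial_deriv k (Gam m l m) x)"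
proof -
  define D where "D k = (\<chi> i j. partial_deriv k (G i j) x)" for k
  define h where "h = (\<chi> i j. H i j x)"
  have dH: "partial_deriv k (H i j) x = - (h ** D k ** h) $ i $ j" for k i j
  proof -
    have "(\<Sum>a\<in>UNIV. \<Sum>b\<in>UNIV. H i a x * partial_deriv k (G a b) x * H b j x) =
        (\<Sum>b\<in>UNIV. \<Sum>a\<in>UNIV. H i a x * partial_deriv k (G a b) x * H b j x)"
      by (rule sum.swap)
    then show ?thesis
      by (simp add: partial_deriv_inv_metric[OF x] matrix_matrix_mult_def h_def D_def sum_distrib_right)
  qed
  \<comment> \<open>Both parts are symmetric in \<open>l\<close> and \<open>k\<close>: the first
    because partial derivatives commute, the second by cyclicity of the trace.\<close>
  have L: "(\<Sum>m\<in>UNIV. partial_deriv l (Gam m k m) x) =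
     (\<Sum>m\<in>UNIV. \<Sum>p\<in>UNIV. H m p x * partial_deriv l (partial_deriv k (G p m)) x) / 2
     - trace (h ** D l ** h ** D k) / 2" for l k
  proof -
    have "(\<Sum>m\<in>UNIV. partial_deriv l (Gam m k m) x) = partial_deriv l (\<lambda>y. \<Sum>m\<in>UNIV. Gam m k m y) x"
      by (simp add: partial_deriv_sum diffs x)
    also have "\<dots> = partial_deriv l (\<lambda>y. (\<Sum>m\<in>UNIV. \<Sum>p\<in>UNIV. H m p y * partial_deriv k (G p m) y) / 2) x"
      by (rule partial_deriv_cong[OF _ open_img x]) (simp_all add: christoffel_trace diffs x)
    also have "\<dots> = (\<Sum>m\<in>UNIV. \<Sum>p\<in>UNIV. partial_deriv l (H m p) x * partial_deriv k (G p m) x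
          + H m p x * partial_deriv l (partial_deriv k (G p m)) x) / 2"
      by (simp add: partial_deriv_cdivide partial_deriv_mult partial_deriv_sum diffs x)
    also have "\<dots> = (\<Sum>m\<in>UNIV. \<Sum>p\<in>UNIV. H m p x * partial_deriv l (partial_deriv k (G p m)) x) / 2
        + (\<Sum>m\<in>UNIV. \<Sum>p\<in>UNIV. - (h ** D l ** h) $ m $ p * D k $ p $ m) / 2"
      by (simp add: sum.distrib sum_subtractf sum_negf dH D_def diff_divide_distrib)
    also have "(\<Sum>m\<in>UNIV. \<Sum>p\<in>UNIV. - (h ** D l ** h) $ m $ p * D k $ p $ m) = - trace (h ** D l ** h ** D k)"
      by (simp add: trace_def matrix_matrix_mult_def[of _ "D k"] sum_negf)
    finally show ?thesis by simp
  qed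
  have "trace (h ** D l ** h ** D k) = trace (h ** D k ** h ** D l)"
    by (metis matrix_mul_assoc trace_mul_sym)
  then show ?thesis
    unfolding L using smooth_partial_deriv_commute[OF open_img smooth_metric x] by simp
qed

text \<open>Of the four sums in \<open>F\<close>, the first and third are symmetric because the
  Christoffel symbols are, the second by \<open>christoffel_trace_closed\<close>, and the fourth
  after renaming its summation indices.\<close>

lemma ricci_sym:
  assumes x: "x \<in> U"
  shows "Rc k l x = Rc l k x"
proof -
  have F: "Rc k l x = (\<Sum>m\<in>UNIV. partial_deriv m (Gam m k l) x) - (\<Sum>m\<in>UNIV. partial_deriv k (Gam m l m) x)
      + (\<Sum>m\<in>UNIV. \<Sum>p\<in>UNIV. Gam p k l x * Gam m m p x)
      - (\<Sum>m\<in>UNIV. \<Sum>p\<in>UNIV. Gam p l m x * Gam m k p x)" for k l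
  proof -
    have "Rc k l x = - (\<Sum>m\<in>UNIV. partial_deriv k (Gam m l m) x - partial_deriv m (Gam m k l) x
        + (\<Sum>p\<in>UNIV. Gam p l m x * Gam m k p x - Gam p k l x * Gam m m p x))"
    proof -
      have "Gam p m l x = Gam p l m x" "partial_deriv k (Gam m m l) x = partial_deriv k (Gam m l m) x" for m p
        using christoffel_sym[OF x] partial_deriv_christoffel_sym[OF x] by blast+
      then show ?thesis by simp
    qed
    then show ?thesis
      by (simp only: sum.distrib sum_subtractf)
  qed
  have "(\<Sum>m\<in>UNIV. \<Sum>p\<in>UNIV. Gam p l m x * Gam m k p x) = (\<Sum>p\<in>UNIV. \<Sum>m\<in>UNIV. Gam p l m x * Gam m k p x)"
    by (rule sum.swap)
  also have "\<dots> = (\<Sum>m\<in>UNIV. \<Sum>p\<in>UNIV. Gam p k m x * Gam m l p x)"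
    by (simp add: mult.commute)
  finally show ?thesis
    unfolding F christoffel_trace_closed[OF x, of k l] christoffel_sym[OF x, of _ k l]
        partial_deriv_christoffel_sym[OF x, of _ _ k l] by simp
qed

end

section \<open>The contracted second Bianchi identity\<close>

lemma matrix_add_mult: "(A + B) ** C = A ** C + B ** (C :: 'a::semiring_1^'n^'m)"
  by (vector matrix_matrix_mult_def sum.distrib distrib_right)

lemma matrix_diff_mult: "(A - B) ** C = A ** C - B ** (C :: 'a::ring_1^'n^'m)"
  by (vector matrix_matrix_mult_def sum_subtractf left_diff_distrib)

lemma matrix_mult_diff: "A ** (B - C) = A ** B - A ** (C :: 'a::ring_1^'n^'m)"
  by (vector matrix_matrix_mult_def sum_subtractf right_diff_distrib)

context metric_chart
begin

text \<open>From here on curvature components are atoms; \<open>riemann_fun\<close> and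
  \<open>ricci_fun\<close> expand them on demand.\<close>

declare riemann.simps [simp del] ricci.simps [simp del]

lemma riemann_antisym: "Rm j k l m x = - Rm k j l m x"
  by (simp add: riemann_fun sum_subtractf)

lemma partial_deriv_riemann_antisym:
  "x \<in> U \<Longrightarrow> partial_deriv i (Rm j k l m) x = - partial_deriv i (Rm k j l m) x"
proof -
  assume x: "x \<in> U"
  have "Rm j k l m = (\<lambda>y. - Rm k j l m y)"
    by (rule ext) (rule riemann_antisym)
  then show ?thesis
    by (metis partial_deriv_minus smooth_riemann smooth_imp_differentiable x)
qed

lemma nabla_riemann:
  "nabla g (riemann g) c [m] [i, j, k, l] x =
     partial_deriv i (Rm j k l m) x + (\<Sum>p\<in>UNIV. Gam m i p x * Rm j k l p x)
     - (\<Sum>p\<in>UNIV. Gam p i j x * Rm p k l m x) - (\<Sum>p\<in>UNIV. Gam p i k x * Rm j p l m x)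
     - (\<Sum>p\<in>UNIV. Gam p i l x * Rm j k p m x)"
  by simp

lemma nabla_riemann_antisym:
  assumes x: "x \<in> U"
  shows "nabla g (riemann g) c [m] [i, j, k, l] x = - nabla g (riemann g) c [m] [i, k, j, l] x"
proof -
  have R: "Rm j k p q x = - Rm k j p q x" "Rm j p l m x = - Rm p j l m x" "Rm p k l m x = - Rm k p l m x"  for p q
    by (rule riemann_antisym)+
  show ?thesis
    unfolding nabla_riemann partial_deriv_riemann_antisym[OF x, of i m j]
    by (simp add: R sum_negf)
qed

text \<open>For fixed \<open>j\<close> and \<open>k\<close> the curvature is a matrix in
  \<open>m\<close> and \<open>l\<close>, built from derivatives and a commutator of connection
  matrices. In the cyclic sum, second derivatives cancel by commutation and the matrix products
  cancel in pairs.\<close>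

lemma second_bianchi:
  assumes x: "x \<in> U"
  shows "nabla g (riemann g) c [m] [i, j, k, l] x + nabla g (riemann g) c [m] [j, k, i, l] x
    + nabla g (riemann g) c [m] [k, i, j, l] x = 0"
proof -
  define \<Gamma> where "\<Gamma> i = (\<chi> m l. Gam m i l x)" for i
  define D where "D i j = (\<chi> m l. partial_deriv i (Gam m j l) x)" for i j
  define E where "E i j k = (\<chi> m l. partial_deriv i (partial_deriv j (Gam m k l)) x)" for i j k
  define R where "R j k = (\<chi> m l. Rm j k l m x)" for j k
  define dR where "dR i j k = (\<chi> m l. partial_deriv i (Rm j k l m) x)" for i j k
  have E_sym: "E i j k = E j i k" for i j k
    unfolding E_def using smooth_partial_deriv_commute[OF open_img smooth_christoffel x]
    by (simp add: vec_eq_iff)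
  have R: "R j k = D k j - D j k + \<Gamma> k ** \<Gamma> j - \<Gamma> j ** \<Gamma> k" for j k
    by (simp add: R_def D_def \<Gamma>_def vec_eq_iff riemann_fun matrix_matrix_mult_def sum_subtractf mult.commute)
  have dR: "dR i j k = E i k j - E i j k + D i k ** \<Gamma> j + \<Gamma> k ** D i j - D i j ** \<Gamma> k - \<Gamma> j ** D i k" for i j k
    by (simp add: dR_def E_def D_def \<Gamma>_def vec_eq_iff riemann_fun matrix_matrix_mult_def sum_subtractf
        partial_deriv_add partial_deriv_diff partial_deriv_sum partial_deriv_mult diffs x sum.distrib mult.commute)
  \<comment> \<open>The covariant derivative with Christoffel corrections for the matrix indices
    \<open>m\<close> and \<open>l\<close> only.\<close>
  define C where "C i j k = dR i j k + \<Gamma> i ** R j k - R j k ** \<Gamma> i" for i j k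
  have C: "C i j k + C j k i + C k i j = 0"
    unfolding C_def R dR
    by (simp add: matrix_add_mult matrix_diff_mult matrix_mult_diff matrix_add_ldistrib matrix_mul_assoc
        E_sym[of j i] E_sym[of k i] E_sym[of k j])
  \<comment> \<open>The corrections for the other two indices become, by antisymmetry of the
    curvature and symmetry of the connection, a difference of one expression and its cyclic shift,
    so they telescope.\<close>
  have N: "nabla g (riemann g) c [m] [i, j, k, l] x = C i j k $ m $ l
     - (\<Sum>p\<in>UNIV. Gam p i j x * Rm p k l m x) + (\<Sum>p\<in>UNIV. Gam p k i x * Rm p j l m x)" for i j k
  proof -
    have "Gam p i k x * Rm j p l m x = - (Gam p k i x * Rm p j l m x)" for p
      using riemann_antisym[of m j p l x] christoffel_sym[OF x, of p i k] by simp
    then have "(\<Sum>p\<in>UNIV. Gam p i k x * Rm j p l m x) = - (\<Sum>p\<in>UNIV. Gam p k i x * Rm p j l m x)"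
      by (simp add: sum_negf)
    moreover have "(\<Sum>p\<in>UNIV. Rm j k p m x * Gam p i l x) = (\<Sum>p\<in>UNIV. Gam p i l x * Rm j k p m x)"
      by (simp add: mult.commute)
    ultimately show ?thesis
      unfolding nabla_riemann by (simp add: C_def dR_def \<Gamma>_def R_def matrix_matrix_mult_def)
  qed
  have "(C i j k + C j k i + C k i j) $ m $ l = 0"
    using C by simp
  then show ?thesis
    unfolding N by simp
qed

lemma nabla_ricci:
  "nabla g (ricci g) c [] [i, k, l] x = partial_deriv i (Rc k l) x
     - (\<Sum>p\<in>UNIV. Gam p i k x * Rc p l x) - (\<Sum>p\<in>UNIV. Gam p i l x * Rc k p x)"
  by simp

text \<open>Contraction commutes with \<open>nabla\<close>, since the corrections for the upper and
  the contracted lower index cancel. The sign is that of the Ricci convention.\<close>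

lemma nabla_riemann_trace:
  assumes x: "x \<in> U"
  shows "(\<Sum>m\<in>UNIV. nabla g (riemann g) c [m] [i, m, k, l] x) = - nabla g (ricci g) c [] [i, k, l] x"
proof -
  have d: "partial_deriv i (Rc k l) x = - (\<Sum>m\<in>UNIV. partial_deriv i (Rm m k l m) x)"
    unfolding ricci_fun by (simp add: partial_deriv_minus partial_deriv_sum diffs x)
  have up: "(\<Sum>m\<in>UNIV. \<Sum>p\<in>UNIV. Gam m i p x * Rm m k l p x) = (\<Sum>m\<in>UNIV. \<Sum>p\<in>UNIV. Gam p i m x * Rm p k l m x)"
    by (rule sum.swap)
  have lo: "(\<Sum>p\<in>UNIV. Gam p i a x * (\<Sum>m\<in>UNIV. f m p)) = (\<Sum>m\<in>UNIV. \<Sum>p\<in>UNIV. Gam p i a x * f m p)"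
    for a and f :: "'n \<Rightarrow> 'n \<Rightarrow> real"
    unfolding sum_distrib_left by (rule sum.swap)
  show ?thesis
    unfolding nabla_riemann nabla_ricci d
    by (simp add: sum.distrib sum_subtractf up ricci_fun sum_negf lo)
qed

text \<open>Contract the second Bianchi identity over the upper index: one term is the divergence,
  the other two are traces, one of them after an antisymmetry flip.\<close>

lemma divergence_riemann:
  assumes x: "x \<in> U"
  shows "divergence g (riemann g) c [j, k, l] x =
    nabla g (ricci g) c [] [k, j, l] x - nabla g (ricci g) c [] [j, k, l] x"
proof -
  have "(\<Sum>m\<in>UNIV. nabla g (riemann g) c [m] [m, j, k, l] x + nabla g (riemann g) c [m] [j, k, m, l] x
      + nabla g (riemann g) c [m] [k, m, j, l] x) = 0"
    by (simp only: second_bianchi[OF x] sum.neutral_const)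
  then have "divergence g (riemann g) c [j, k, l] x
      - (\<Sum>m\<in>UNIV. nabla g (riemann g) c [m] [j, m, k, l] x)
      + (\<Sum>m\<in>UNIV. nabla g (riemann g) c [m] [k, m, j, l] x) = 0"
    unfolding divergence_def sum.distrib nabla_riemann_antisym[OF x, of _ j k] sum_negf by linarith
  then show ?thesis
    unfolding nabla_riemann_trace[OF x] by linarith
qed

end

section \<open>Closedness of the one-form\<close>

context metric_chart
begin

text \<open>Differentiating \<open>eq\<close> and summing cyclically over \<open>i\<close>, \<open>k\<close>, \<open>j\<close> leaves only the curl
  of \<open>w\<close>: the Hessian of \<open>\<psi>\<close> cancels by symmetry, the terms \<open>w w Z\<close> cancel in pairs, and
  the Christoffel terms cancel by \<open>eq\<close> itself.\<close>

lemma cyclic_curl: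
  assumes x: "x \<in> U"
    and w: "\<And>k. smooth_fun_on U (w k)" and Z: "\<And>j l. smooth_fun_on U (Z j l)"
    and \<psi>: "smooth_fun_on U \<psi>"
    and eq: "\<And>y j k l. y \<in> U \<Longrightarrow> w k y * Z j l y - w j y * Z k l y =
        G j l y * partial_deriv k \<psi> y - G k l y * partial_deriv j \<psi> y"
    and dZ: "\<And>i j l. partial_deriv i (Z j l) x - partial_deriv j (Z i l) x =
        w i x * Z j l x - w j x * Z i l x
        + (\<Sum>q\<in>UNIV. Gam q i l x * Z j q x) - (\<Sum>q\<in>UNIV. Gam q j l x * Z i q x)"
  shows "(partial_deriv i (w k) x - partial_deriv k (w i) x) * Z j l x
    + (partial_deriv k (w j) x - partial_deriv j (w k) x) * Z i l x
    + (partial_deriv j (w i) x - partial_deriv i (w j) x) * Z k l x = 0"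
proof -
  note df = w[THEN smooth_imp_differentiable, OF x] Z[THEN smooth_imp_differentiable, OF x]
    diffs[OF x] smooth_imp_differentiable[OF smooth_partial_deriv[OF \<psi>] x]
  define p where "p k = partial_deriv k \<psi> x" for k
  define S where "S i j l = (\<Sum>q\<in>UNIV. Gam q i l x * Z j q x)" for i j l
  define V where "V i j l = (\<Sum>q\<in>UNIV. Gam q i l x * G j q x)" for i j l
  have d: "partial_deriv i (w k) x * Z j l x + w k x * partial_deriv i (Z j l) x
      - (partial_deriv i (w j) x * Z k l x + w j x * partial_deriv i (Z k l) x)
     = partial_deriv i (G j l) x * p k + G j l x * partial_deriv i (partial_deriv k \<psi>) x
      - (partial_deriv i (G k l) x * p j + G k l x * partial_deriv i (partial_deriv j \<psi>) x)" for i j k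
  proof -
    have "partial_deriv i (\<lambda>y. w k y * Z j l y - w j y * Z k l y) x =
        partial_deriv i (\<lambda>y. G j l y * partial_deriv k \<psi> y - G k l y * partial_deriv j \<psi> y) x"
      by (rule partial_deriv_cong[OF _ open_img x]) (simp_all add: eq df)
    then show ?thesis
      by (simp add: partial_deriv_diff partial_deriv_mult df p_def)
  qed
  have hess: "partial_deriv i (partial_deriv k \<psi>) x = partial_deriv k (partial_deriv i \<psi>) x" for i k
    by (rule smooth_partial_deriv_commute[OF open_img \<psi> x])
  \<comment> \<open>Exchanging the derivative index with the first tensor index brings the
    derivatives of \<open>Z\<close> in the cyclic sum into matching pairs; \<open>dG\<close> does
    the same for the metric.\<close>
  have dZ': "partial_deriv i (Z j l) x =
      partial_deriv j (Z i l) x + w i x * Z j l x - w j x * Z i l x + S i j l - S j i l" for i j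
    using dZ[of i j l] unfolding S_def by linarith
  have dG: "partial_deriv i (G j l) x = partial_deriv j (G i l) x + V i j l - V j i l" for i j
    using metric_compatible[OF x, of i j l] metric_compatible[OF x, of j i l]
      christoffel_sym[OF x, of _ i j] unfolding V_def by simp
  \<comment> \<open>This is \<open>eq\<close> contracted with a Christoffel symbol in its last
    index; it matches the corrections from \<open>dZ'\<close> with those from
    \<open>dG\<close>.\<close>
  have SV: "w k x * S i j l - w j x * S i k l = p k * V i j l - p j * V i k l" for i j k
  proof -
    have "w k x * S i j l - w j x * S i k l =
        (\<Sum>q\<in>UNIV. Gam q i l x * (w k x * Z j q x - w j x * Z k q x))"
      by (simp add: S_def sum_distrib_left sum_subtractf right_diff_distrib mult_ac)
    also have "\<dots> = p k * V i j l - p j * V i k l"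
      by (simp add: eq[OF x] V_def p_def sum_distrib_left sum_subtractf right_diff_distrib mult_ac)
    finally show ?thesis .
  qed
  show ?thesis
    using d[of i k j] d[of k j i] d[of j i k] SV[of k i j] SV[of j k i] SV[of i j k]
    unfolding dZ'[of k i] dZ'[of j k] dZ'[of j i] dG[of k i] dG[of j k] dG[of j i]
      hess[of k i] hess[of j k] hess[of j i]
    by (simp add: algebra_simps)
qed

end

text \<open>For \<open>j\<close> different from \<open>i\<close> and \<open>k\<close>, contracting
  the cyclic identity with column \<open>j\<close> of the inverse turns the three factors
  \<open>Z\<close> into 1, 0 and 0.\<close>

lemma curl_eq_0:
  fixes F :: "'n::finite \<Rightarrow> 'n \<Rightarrow> real"
  assumes card: "CARD('n) > 2"
    and cyc: "\<And>i k j l. F i k * Z j l + F k j * Z i l + F j i * Z k l = 0"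
    and inv: "\<And>h l. (\<Sum>k\<in>UNIV. Y k h * Z l k) = of_bool (h = l)"
  shows "F i k = 0"
proof -
  have "card {i, k} < CARD('n)"
    using card by (cases "i = k") auto
  then have "{i, k} \<noteq> UNIV"
    by (metis less_irrefl)
  then obtain j where j: "j \<noteq> i" "j \<noteq> k"
    by auto
  have "0 = (\<Sum>l\<in>UNIV. Y l j * (F i k * Z j l + F k j * Z i l + F j i * Z k l))"
    by (simp add: cyc)
  also have "\<dots> = F i k * (\<Sum>l\<in>UNIV. Y l j * Z j l) + F k j * (\<Sum>l\<in>UNIV. Y l j * Z i l)
      + F j i * (\<Sum>l\<in>UNIV. Y l j * Z k l)"
    by (simp add: sum_distrib_left sum.distrib distrib_left mult_ac)
  also have "\<dots> = F i k"
    using j by (simp add: inv)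
  finally show ?thesis by simp
qed

section \<open>From the manifold to a single chart\<close>

lemma tensor_field_smooth:
  "tensor_field \<A> r s T \<Longrightarrow> c \<in> \<A> \<Longrightarrow> length us = r \<Longrightarrow> length ls = s \<Longrightarrow>
    smooth_fun_on (chart_img c) (T c us ls)"
  unfolding tensor_field_def by blast

text \<open>The transformation law is linear in the components. Used to see that
  \<open>\<omega>\<close> is a covector field, which is part of
  \<open>closed_one_form\<close>.\<close>

lemma tensor_field_diff:
  assumes T: "tensor_field \<A> r s T" and S: "tensor_field \<A> r s S"
    and "\<And>c. c \<in> \<A> \<Longrightarrow> open (chart_img c)"
  shows "tensor_field \<A> r s (\<lambda>c us ls x. T c us ls x - S c us ls x)"
proof -
  have "smooth_fun_on (chart_img c) (\<lambda>x. T c us ls x - S c us ls x)"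
    if "c \<in> \<A>" "length us = r" "length ls = s" for c us ls
    using that assms by (intro smooth_diff) (auto intro: tensor_field_smooth)
  then show ?thesis
    using T S unfolding tensor_field_def by (simp add: right_diff_distrib sum_subtractf)
qed

lemma metric_chartI:
  fixes \<A> :: "('a, 'n::finite) chart set"
  assumes "riemannian_manifold M \<A> g" "c \<in> \<A>"
  shows "metric_chart g c"
proof
  have M: "smooth_manifold M \<A>" and g: "riemannian_metric \<A> g"
    using assms unfolding riemannian_manifold_def by auto
  show "open (chart_img c)"
    using M assms(2) unfolding smooth_manifold_def is_chart_def by blast
  show "smooth_fun_on (chart_img c) (g c [] [i, j])" for i j
    using g assms(2) unfolding riemannian_metric_def by (auto intro: tensor_field_smooth)
  show "g c [] [i, j] x = g c [] [j, i] x" if "x \<in> chart_img c" for x i j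
    using g assms(2) that unfolding riemannian_metric_def by blast
  show "(\<Sum>i\<in>UNIV. \<Sum>j\<in>UNIV. g c [] [i, j] x * v $ i * v $ j) > 0"
    if "x \<in> chart_img c" "v \<noteq> 0" for x and v :: "real^'n"
    using g assms(2) that unfolding riemannian_metric_def by blast
qed

theorem theorem4p8:
  fixes M :: "'a topology"
    and \<A> :: "('a, 'n::finite) chart set"
    and g \<phi> a b d K \<omega> :: "('a, 'n) components"
    and A B :: real
  assumes "CARD('n) > 3"
    and "riemannian_manifold M \<A> g"
    and "weakly_Z_symmetric \<A> g \<phi> a b d"
    and "nonsingular \<A> (Z_tensor g \<phi>)"
    and "generalized_curvature_tensor \<A> K"
    and "A \<noteq> 0"
    and "\<forall>c\<in>\<A>. \<forall>x\<in>chart_img c. \<forall>j k l.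
           divergence g K c [j, k, l] x =
             A * divergence g (riemann g) c [j, k, l] x
             + B * (g c [] [k, l] x * nabla g (scalar_curv g) c [] [j] x
                    - g c [] [j, l] x * nabla g (scalar_curv g) c [] [k] x)"
    and "harmonic \<A> g K"
    and "\<omega> = (\<lambda>c us ls x. a c us ls x - b c us ls x)"
    and "\<exists>c\<in>\<A>. \<exists>x\<in>chart_img c. \<exists>k. \<omega> c [] [k] x \<noteq> 0"
  shows "closed_one_form \<A> g \<omega>"
proof -
  have a: "tensor_field \<A> 0 1 a" and b: "tensor_field \<A> 0 1 b" and \<phi>: "tensor_field \<A> 0 0 \<phi>"
    using assms(3) unfolding weakly_Z_symmetric_def by auto
  have \<omega>: "tensor_field \<A> 0 1 \<omega>"
    unfolding assms(9) using a b metric_chart.open_img[OF metric_chartI[OF assms(2)]]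
    by (intro tensor_field_diff)
  have "nabla g \<omega> c [] [i, j] x - nabla g \<omega> c [] [j, i] x = 0"
    if c: "c \<in> \<A>" and x: "x \<in> chart_img c" for c x i j
  proof -
    interpret metric_chart g c
      using assms(2) c by (rule metric_chartI)
    define w where "w k = \<omega> c [] [k]" for k
    define Z where "Z j l = Z_tensor g \<phi> c [] [j, l]" for j l
    define f where "f = \<phi> c [] []"
    define R where "R = scalar_curv g c [] []"
    \<comment> \<open>The ratio left when the vanishing divergence of \<open>K\<close> is solved for
      that of the Riemann tensor, dividing by \<open>A\<close>.\<close>
    define r where "r = B / A"
    define \<psi> where "\<psi> y = f y + r * R y" for y
    have sf: "smooth_fun_on U f"
      unfolding f_def using \<phi> c by (auto intro: tensor_field_smooth)
    have sR: "smooth_fun_on U R"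
      unfolding R_def by (rule smooth_scalar_curv)
    have sw: "smooth_fun_on U (w k)" for k
      unfolding w_def using \<omega> c by (auto intro: tensor_field_smooth)
    have Z_fun: "Z j l = (\<lambda>y. Rc j l y + f y * G j l y)" for j l
      by (simp add: Z_def f_def Z_tensor_def fun_eq_iff)
    have sZ: "smooth_fun_on U (Z j l)" for j l
      unfolding Z_fun by (intro smooth_add smooth_mult open_img smooth_ricci sf smooth_metric)
    have s\<psi>: "smooth_fun_on U \<psi>"
      unfolding \<psi>_def by (intro smooth_add smooth_mult smooth_const open_img sf sR)
    have Z_sym: "Z j l y = Z l j y" if "y \<in> U" for y j l
      unfolding Z_fun using ricci_sym[OF that, of j l] metric_sym[OF that, of j l] by simp
    note df = smooth_imp_differentiable[OF smooth_ricci] smooth_imp_differentiable[OF sf]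
      smooth_imp_differentiable[OF sR] smooth_imp_differentiable[OF smooth_metric]
    have nabla_Z: "nabla g (Z_tensor g \<phi>) c [] [k, j, l] y =
        partial_deriv k (Z j l) y - (\<Sum>p\<in>UNIV. Gam p k j y * Z p l y) - (\<Sum>p\<in>UNIV. Gam p k l y * Z j p y)"
      for k j l y
      by (simp add: Z_def)
    have wzs: "nabla g (Z_tensor g \<phi>) c [] [k, j, l] y - nabla g (Z_tensor g \<phi>) c [] [j, k, l] y =
        w k y * Z j l y - w j y * Z k l y" if y: "y \<in> U" for y j k l
    proof -
      have "nabla g (Z_tensor g \<phi>) c [] [k, j, l] y = a c [] [k] y * Z j l y
          + b c [] [j] y * Z k l y + d c [] [l] y * Z k j y" for k j l
        using assms(3) c y unfolding weakly_Z_symmetric_def Z_def by blast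
      then show ?thesis
        using Z_sym[OF y, of j k] by (simp add: w_def assms(9) algebra_simps)
    qed
    have eq: "w k y * Z j l y - w j y * Z k l y = G j l y * partial_deriv k \<psi> y - G k l y * partial_deriv j \<psi> y"
      if y: "y \<in> U" for y j k l
    proof -
      have d\<psi>: "partial_deriv k \<psi> y = partial_deriv k f y + r * partial_deriv k R y" for k
        unfolding \<psi>_def using y
        by (subst partial_deriv_add) (auto simp: df partial_deriv_mult partial_deriv_const)
      \<comment> \<open>Since the metric is parallel, only the derivative of the scalar
        \<open>f\<close> survives in the trace term of \<open>Z\<close>.\<close>
      have nZ: "nabla g (Z_tensor g \<phi>) c [] [k, j, l] y =
          nabla g (ricci g) c [] [k, j, l] y + partial_deriv k f y * G j l y" for k j l
      proof -
        have "partial_deriv k (Z j l) y = partial_deriv k (Rc j l) y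
            + (partial_deriv k f y * G j l y + f y * partial_deriv k (G j l) y)"
          unfolding Z_fun using y by (simp add: partial_deriv_add partial_deriv_mult df)
        then show ?thesis
          unfolding nabla_Z nabla_ricci metric_compatible[OF y, of k j l]
          by (simp add: Z_fun algebra_simps sum.distrib sum_distrib_left)
      qed
      have "A * divergence g (riemann g) c [j, k, l] y
          + B * (G k l y * nabla g (scalar_curv g) c [] [j] y - G j l y * nabla g (scalar_curv g) c [] [k] y) = 0"
        using assms(7,8) c y unfolding harmonic_def by simp
      then have "divergence g (riemann g) c [j, k, l] y =
          r * (G j l y * partial_deriv k R y - G k l y * partial_deriv j R y)"
        using assms(6) by (simp add: R_def r_def field_simps)
      then show ?thesis
        unfolding wzs[OF y, symmetric] nZ d\<psi> divergence_riemann[OF y] by (simp add: algebra_simps)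
    qed
    \<comment> \<open>The Christoffel terms in the antisymmetrised pair of indices cancel by
      symmetry; those acting on \<open>l\<close> remain.\<close>
    have dZ: "partial_deriv i (Z j l) x - partial_deriv j (Z i l) x = w i x * Z j l x - w j x * Z i l x
        + (\<Sum>q\<in>UNIV. Gam q i l x * Z j q x) - (\<Sum>q\<in>UNIV. Gam q j l x * Z i q x)" for i j l
      using wzs[OF x, of i j l] christoffel_sym[OF x, of _ i j] unfolding nabla_Z by simp
    obtain Y where "\<forall>c\<in>\<A>. \<forall>x\<in>chart_img c. \<forall>h l.
        (\<Sum>k\<in>UNIV. Y c [k, h] [] x * Z_tensor g \<phi> c [] [k, l] x) = (if h = l then 1 else 0)"
      using assms(4) unfolding nonsingular_def by (elim exE conjE) (rule that)
    from this[rule_format, OF c x]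
    have Y: "(\<Sum>k\<in>UNIV. Y c [k, h] [] x * Z k l x) = of_bool (h = l)" for h l
      by (simp add: Z_def)
    have "partial_deriv i (w j) x - partial_deriv j (w i) x = 0"
    proof (rule curl_eq_0[where F = "\<lambda>i j. partial_deriv i (w j) x - partial_deriv j (w i) x"])
      show "CARD('n) > 2" using assms(1) by simp
      \<comment> \<open>\<open>nonsingular\<close> contracts the first index of \<open>Z\<close>,
        \<open>curl_eq_0\<close> the second; the symmetry of \<open>Z\<close> bridges the
        two.\<close>
      show "(\<Sum>k\<in>UNIV. Y c [k, h] [] x * Z l k x) = of_bool (h = l)" for h l
        using Y[of h l] Z_sym[OF x, of l] by simp
    qed (rule cyclic_curl[OF x sw sZ s\<psi> eq dZ])
    \<comment> \<open>For a one-form the Christoffel terms drop out of the antisymmetrised covariant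
      derivative, leaving the ordinary curl.\<close>
    then show ?thesis
      using christoffel_sym[OF x, of _ i j] by (simp add: w_def)
  qed
  then show ?thesis
    using \<omega> unfolding closed_one_form_def by blast
qed

end
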